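(* Let $s\ge1$ be an integer and let $\mathcal H_s(y,z):=\sum_{k\ge0}H_k^{(s)}(y)z^k=\sum_{d\ge0}h_d^{(s)}(z)\,y^d$. Then, as formal power series in $z$ with coefficients formal power series in $y$, $$\mathcal H_s(y,z)=(1-z)\sum_{m\ge0}G_m^{(s)}\bigl((1-z)y\bigr)z^m.$$ Equivalently, for every $k\ge0$, $H_k^{(s)}(y)=[z^k]\Bigl((1-z)\sum_{m\ge0}G_m^{(s)}\bigl((1-z)y\bigr)z^m\Bigr)$.
   Context: For integers $d\ge2$ and $s\ge1$ let $$\mathcal P_d^{(s)}=\{x=(x_1,\dots,x_d)\in\mathbb R_{\ge0}^d:\ x_i+x_{i+1}\le s+\delta_i,\ 1\le i\le d-1\},$$ where $\delta_i=0$ for $i$ odd and $\delta_i=1$ for $i$ even; this is a lattice polytope. By convention $\mathcal P_0^{(s)}=\{0\}$ and $\mathcal P_1^{(s)}=[0,s]$. For $d\ge0$, $m\ge0$ let $L_d^{(s)}(m):=\#(m\mathcal P_d^{(s)}\cap\mathbb Z^d)$; in particular $L_0^{(s)}(m)=1$ and $L_1^{(s)}(m)=sm+1$, and $L_d^{(s)}(0)=1$. The $h^*$-polynomial $h_d^{(s)}(z)=\sum_{k=0}^d h_{d,k}^{(s)}z^k$ is defined by $$\sum_{m\ge0}L_d^{(s)}(m)z^m=\frac{h_d^{(s)}(z)}{(1-z)^{d+1}},$$ and $h_{d,k}^{(s)}:=0$ for $k>d$. Define $G_m^{(s)}(y):=\sum_{d\ge0}L_d^{(s)}(m)\,y^d$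 and $H_k^{(s)}(y):=\sum_{d\ge0}h_{d,k}^{(s)}\,y^d$. *)

theory Defs
  imports "HOL-Computational_Algebra.Computational_Algebra"
begin

text \<open>
  A point of $R^d$ is a function on the naturals that vanishes off \<open>{1..d}\<close>, so that
  the dimension \<open>d\<close> can vary inside a formula.
\<close>

definition Rn :: "nat \<Rightarrow> (nat \<Rightarrow> real) set" where
  "Rn d = {x. \<forall>i. i \<notin> {1..d} \<longrightarrow> x i = 0}"

definition Zn :: "nat \<Rightarrow> (nat \<Rightarrow> real) set" where
  "Zn d = {x \<in> Rn d. \<forall>i. x i \<in> \<int>}"

definition delta :: "nat \<Rightarrow> nat" where
  "delta i = (if odd i then 0 else 1)"

definition polyP :: "nat \<Rightarrow> nat \<Rightarrow> (nat \<Rightarrow> real) set" where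
  "polyP s d =
     (if d = 0 then {\<lambda>_. 0}
      else if d = 1 then {x \<in> Rn 1. 0 \<le> x 1 \<and> x 1 \<le> real s}
      else {x \<in> Rn d. (\<forall>i\<in>{1..d}. 0 \<le> x i) \<and>
                      (\<forall>i\<in>{1..d - 1}. x i + x (i + 1) \<le> real (s + delta i))})"

definition dilate :: "nat \<Rightarrow> (nat \<Rightarrow> real) set \<Rightarrow> (nat \<Rightarrow> real) set" where
  "dilate m A = (\<lambda>x i. real m * x i) ` A"

definition ehrhart :: "nat \<Rightarrow> nat \<Rightarrow> nat \<Rightarrow> nat" where
  "ehrhart s d m = card (dilate m (polyP s d) \<inter> Zn d)"

text \<open>
  Uniqueness of the polynomial below is immediate, as \<open>(1 - fps_X) ^ (d + 1)\<close> is a unit.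
  Its existence, including the degree bound, is the theorem of Ehrhart and Stanley for the
  lattice polytope \<open>polyP s d\<close>. In particular \<open>coeff (hstar s d) k = 0\<close> for \<open>k > d\<close>.
\<close>

definition hstar :: "nat \<Rightarrow> nat \<Rightarrow> real poly" where
  "hstar s d = (THE h. degree h \<le> d \<and>
     Abs_fps (\<lambda>m. real (ehrhart s d m)) = fps_of_poly h / (1 - fps_X) ^ (d + 1))"

definition Gser :: "nat \<Rightarrow> nat \<Rightarrow> real fps" where
  "Gser s m = Abs_fps (\<lambda>d. real (ehrhart s d m))"

definition Hser :: "nat \<Rightarrow> nat \<Rightarrow> real fps" where
  "Hser s k = Abs_fps (\<lambda>d. coeff (hstar s d) k)"

text \<open>
  In \<open>Hgen\<close> the outer variable is $z$ and the inner variable, that of the coefficients,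
  is $y$.
\<close>

definition Hgen :: "nat \<Rightarrow> real fps fps" where
  "Hgen s = Abs_fps (Hser s)"

definition fps_swap :: "'a fps fps \<Rightarrow> 'a fps fps" where
  "fps_swap F = Abs_fps (\<lambda>i. Abs_fps (\<lambda>j. fps_nth (fps_nth F j) i))"

text \<open>
  The series \<open>g((1 - z) y)\<close>, for \<open>g\<close> a series in $y$. The substitution
  is a composition of power series in $y$ over the power series in $z$: there \<open>fps_X\<close> is $y$
  and \<open>fps_const (1 - fps_X)\<close> is $1 - z$, and the inserted series has no constant term.
  The result is then rewritten as a power series in $z$ over the power series in $y$.
\<close>

definition subst_scaled :: "real fps \<Rightarrow> real fps fps" where
  "subst_scaled g =
     fps_swap (Abs_fps (\<lambda>d. fps_const (fps_nth g d)) oo (fps_const (1 - fps_X) * fps_X))"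

end

theory Submission
  imports Defs
begin

text \<open>
  Fix \<open>d\<close>, and write \<open>L m\<close> for \<open>ehrhart s d m\<close>. The coefficient of \<open>y ^ d\<close> in the series
  \<open>G\<^sub>m\<close>, taken at \<open>(1 - z) y\<close>, is \<open>(1 - z) ^ d * L m\<close>. Multiplying by \<open>(1 - z) z ^ m\<close> and
  summing over \<open>m\<close> thus gives \<open>(1 - z) ^ (d + 1)\<close> times the Ehrhart series, which is the
  \<open>h\<^sup>*\<close>-polynomial. So the identity is a comparison of coefficients, once it is known that the
  \<open>h\<^sup>*\<close>-polynomial exists: \<open>hstar\<close> is a definite description, and satisfies its defining
  equation only if some polynomial of degree at most \<open>d\<close> does (\<open>hstar_numerator\<close>). This
  is the substance of the proof, and it amounts to \<open>L\<close> being a polynomial of degree at most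
  \<open>d\<close> at all \<open>m \<ge> 0\<close>.

  Polynomiality follows from building lattice points coordinate by coordinate. Let \<open>K d m v\<close>
  be the number of lattice points of the \<open>m\<close>-th dilate with last coordinate at most \<open>v\<close>
  (\<open>capped_count\<close>). If the last coordinate is \<open>u\<close>, then the preceding one is at most
  \<open>e m - u\<close> with \<open>e = s\<close> or \<open>e = s + 1\<close>. Hence
  \<open>K (d + 1) m v\<close> is the sum of \<open>K d m (e m - u)\<close> over \<open>u \<le> min v (e m)\<close>. As a function of
  \<open>(m, v)\<close> the count is not a polynomial, but it is piecewise polynomial, with all breakpoints
  \<open>v\<close> at multiples of \<open>m\<close>: on the piece \<open>v = j m + r\<close>, \<open>0 \<le> r \<le> m\<close>, it is a polynomial in
  \<open>m\<close> and \<open>r\<close> of total degree at most \<open>d\<close>. The three operations of the recursion, namely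
  reflecting the argument at \<open>e m\<close>, summing, and stopping at \<open>e m\<close>, preserve this form, and only the
  summation raises the degree, by one. Finally \<open>L m = K d m ((s + 1) m)\<close> is the value at the
  start of a piece, hence a polynomial in \<open>m\<close>.
\<close>

section \<open>Functions given by a polynomial in two variables\<close>

text \<open>
  Here \<open>n\<close> bounds the total degree. Generating the polynomials from monomials reduces closure
  properties to monomials and sums.
\<close>

inductive bipoly :: "nat \<Rightarrow> (real \<Rightarrow> real \<Rightarrow> real) \<Rightarrow> bool" for n where
  monom: "a + b \<le> n \<Longrightarrow> bipoly n (\<lambda>m r. c * m ^ a * r ^ b)"
| add: "bipoly n f \<Longrightarrow> bipoly n g \<Longrightarrow> bipoly n (\<lambda>m r. f m r + g m r)"

lemma bipoly_mono:
  assumes "bipoly n f" "n \<le> k"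
  shows "bipoly k f"
  using assms by (induction rule: bipoly.induct) (auto intro: bipoly.intros)

lemma bipoly_const: "bipoly n (\<lambda>m r. c)"
  using bipoly.monom[of 0 0 n c] by simp

lemma bipoly_fst: "n \<ge> 1 \<Longrightarrow> bipoly n (\<lambda>m r. m)"
  using bipoly.monom[of 1 0 n 1] by simp

lemma bipoly_snd: "n \<ge> 1 \<Longrightarrow> bipoly n (\<lambda>m r. r)"
  using bipoly.monom[of 0 1 n 1] by simp

lemma bipoly_mult:
  assumes "bipoly n f" "bipoly k g"
  shows "bipoly (n + k) (\<lambda>m r. f m r * g m r)"
  using assms(1)
proof (induction rule: bipoly.induct)
  case (monom a b c)
  show ?case
    using assms(2)
  proof (induction rule: bipoly.induct)
    case (monom a' b' c')
    then show ?case
      using bipoly.monom[of "a + a'" "b + b'" "n + k" "c * c'"] \<open>a + b \<le> n\<close>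
      by (simp add: power_add mult_ac)
  next
    case (add f g)
    then show ?case using bipoly.add by (fastforce simp: distrib_left)
  qed
next
  case (add f g)
  then show ?case using bipoly.add by (fastforce simp: distrib_right)
qed

lemma bipoly_sum:
  assumes "\<And>i. i \<in> I \<Longrightarrow> bipoly n (f i)"
  shows "bipoly n (\<lambda>m r. \<Sum>i\<in>I. f i m r)"
  using assms
  by (induction I rule: infinite_finite_induct) (auto intro: bipoly_const bipoly.add)

lemma bipoly_cmult:
  assumes "bipoly n f"
  shows "bipoly n (\<lambda>m r. c * f m r)"
  using bipoly_mult[OF bipoly_const[of 0 c] assms] by simp

lemma bipoly_diff:
  assumes "bipoly n f" "bipoly n g"
  shows "bipoly n (\<lambda>m r. f m r - g m r)"
  using bipoly.add[OF assms(1) bipoly_cmult[OF assms(2), of "-1"]] by simp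

lemma bipoly_power:
  assumes "bipoly n f"
  shows "bipoly (n * b) (\<lambda>m r. f m r ^ b)"
proof (induction b)
  case (Suc b)
  then show ?case using bipoly_mult[OF assms Suc] by simp
qed (simp add: bipoly_const)

lemma bipoly_subst:
  assumes "bipoly n f" "bipoly 1 g"
  shows "bipoly n (\<lambda>m r. f m (g m r))"
  using assms(1)
proof (induction rule: bipoly.induct)
  case (monom a b c)
  have "bipoly (a + b) (\<lambda>m r. c * m ^ a * g m r ^ b)"
    using bipoly_mult[OF bipoly.monom[of a 0 a c] bipoly_power[OF assms(2), of b]] by simp
  then show ?case by (rule bipoly_mono) fact
qed (rule bipoly.add)

text \<open>
  Summing \<open>(t + 1) ^ (b + 1) - t ^ (b + 1)\<close> over \<open>t < r\<close> telescopes to \<open>r ^ (b + 1)\<close>; expanded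
  by the binomial theorem it is \<open>(b + 1)\<close> times the power sum with exponent \<open>b\<close>, plus power
  sums with smaller exponents.
\<close>

lemma bipoly_power_sum:
  "\<exists>q. bipoly (Suc b) q \<and> (\<forall>m r. (\<Sum>t<r. real t ^ b) = q m (real r))"
proof (induction b rule: less_induct)
  case (less b)
  then obtain q where q: "\<And>k. k < b \<Longrightarrow> bipoly (Suc k) (q k)"
    "\<And>k m r. k < b \<Longrightarrow> (\<Sum>t<r. real t ^ k) = q k m (real r)" by metis
  define Q where "Q m r = 1 / real (Suc b) *
    (r ^ Suc b - (\<Sum>k<b. real (Suc b choose k) * q k m r))" for m r
  have "bipoly (Suc b) Q"
    unfolding Q_def
    using bipoly_mono[OF q(1)] bipoly.monom[of 0 "Suc b" "Suc b" 1]
    by (intro bipoly_cmult bipoly_diff bipoly_sum) auto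
  moreover have "(\<Sum>t<r. real t ^ b) = Q m (real r)" for m r
  proof -
    have expand: "(real t + 1) ^ Suc b - real t ^ Suc b =
        (\<Sum>k<b. real (Suc b choose k) * real t ^ k) + real (Suc b) * real t ^ b" for t
    proof -
      have "(real t + 1) ^ Suc b = (\<Sum>k\<le>Suc b. real (Suc b choose k) * real t ^ k)"
        unfolding binomial_ring by (simp del: binomial_Suc_Suc sum.atMost_Suc)
      also have "\<dots> = (\<Sum>k<b. real (Suc b choose k) * real t ^ k) + real (Suc b) * real t ^ b
          + real t ^ Suc b"
        unfolding lessThan_Suc_atMost[symmetric] by (simp del: binomial_Suc_Suc)
      finally show ?thesis by simp
    qed
    have "real r ^ Suc b = (\<Sum>t<r. (real t + 1) ^ Suc b - real t ^ Suc b)"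
      using sum_lessThan_telescope[of "\<lambda>t. real t ^ Suc b" r] by (simp add: add.commute)
    also have "\<dots> = (\<Sum>k<b. real (Suc b choose k) * (\<Sum>t<r. real t ^ k))
        + real (Suc b) * (\<Sum>t<r. real t ^ b)"
      unfolding expand sum.distrib sum_distrib_left by (subst sum.swap) (rule refl)
    also have "(\<Sum>k<b. real (Suc b choose k) * (\<Sum>t<r. real t ^ k))
        = (\<Sum>k<b. real (Suc b choose k) * q k m (real r))"
      using q(2)[of _ r m] by (intro sum.cong) auto
    finally have "real (Suc b) * (\<Sum>t<r. real t ^ b) =
        real r ^ Suc b - (\<Sum>k<b. real (Suc b choose k) * q k m (real r))" by linarith
    then show ?thesis unfolding Q_def
      by (metis (no_types, lifting) nonzero_mult_div_cancel_left of_nat_eq_0_iff nat.simps(3)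
          mult.left_neutral times_divide_eq_left)
  qed
  ultimately show ?case by blast
qed

lemma bipoly_partial_sum:
  assumes "bipoly n p"
  shows "\<exists>q. bipoly (Suc n) q \<and> (\<forall>m r. (\<Sum>t<r. p m (real t)) = q m (real r))"
  using assms
proof (induction rule: bipoly.induct)
  case (monom a b c)
  obtain q where q: "bipoly (Suc b) q" "\<And>m r. (\<Sum>t<r. real t ^ b) = q m (real r)"
    using bipoly_power_sum by blast
  have "bipoly (a + Suc b) (\<lambda>m r. c * m ^ a * q m r)"
    using bipoly_mult[OF bipoly.monom[of a 0 a c] q(1)] by simp
  then have "bipoly (Suc n) (\<lambda>m r. c * m ^ a * q m r)"
    by (rule bipoly_mono) (use monom in simp)
  moreover have "(\<Sum>t<r. c * m ^ a * real t ^ b) = c * m ^ a * q m (real r)" for m r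
    by (simp add: q(2)[symmetric] sum_distrib_left)
  ultimately show ?case by blast
next
  case (add f g)
  then obtain p q where "bipoly (Suc n) p" "\<forall>m r. (\<Sum>t<r. f m (real t)) = p m (real r)"
    "bipoly (Suc n) q" "\<forall>m r. (\<Sum>t<r. g m (real t)) = q m (real r)" by blast
  then show ?case
    by (intro exI[of _ "\<lambda>m r. p m r + q m r"]) (auto simp: sum.distrib intro: bipoly.add)
qed

section \<open>Piecewise polynomial functions with breakpoints at multiples of the dilation factor\<close>

text \<open>
  The pieces are the intervals \<open>[j m, (j + 1) m]\<close>. They are closed, so that a polynomial also
  represents the function at both ends of its piece; reflections of the argument, which
  exchange the two ends, therefore preserve the property.
\<close>

definition piecewise_bipoly :: "nat \<Rightarrow> (nat \<Rightarrow> nat \<Rightarrow> nat) \<Rightarrow> bool" where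
  "piecewise_bipoly n K \<longleftrightarrow>
     (\<forall>j. \<exists>p. bipoly n p \<and> (\<forall>m r. r \<le> m \<longrightarrow> real (K m (j * m + r)) = p (real m) (real r)))"

lemma piecewise_bipolyE:
  assumes "piecewise_bipoly n K"
  obtains p where "\<And>j. bipoly n (p j)"
    "\<And>j m r. r \<le> m \<Longrightarrow> real (K m (j * m + r)) = p j (real m) (real r)"
  using assms unfolding piecewise_bipoly_def by metis

lemma piecewise_bipoly_at_multiple:
  assumes "piecewise_bipoly n K"
  shows "\<exists>p. bipoly n p \<and> (\<forall>m. real (K m (j * m)) = p (real m) 0)"
  using assms unfolding piecewise_bipoly_def
  by (metis add_0_right le0 of_nat_0)

lemma bipoly_at_zero: "bipoly n p \<Longrightarrow> bipoly n (\<lambda>m r. p m 0)"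
  by (rule bipoly_subst[OF _ bipoly_const])

lemma piecewise_bipoly_reflect:
  assumes "piecewise_bipoly n K"
  shows "piecewise_bipoly n (\<lambda>m u. K m (e * m - u))"
  unfolding piecewise_bipoly_def
proof
  fix j
  obtain p where p: "\<And>j. bipoly n (p j)"
    "\<And>j m r. r \<le> m \<Longrightarrow> real (K m (j * m + r)) = p j (real m) (real r)"
    using piecewise_bipolyE[OF assms] by blast
  show "\<exists>q. bipoly n q \<and>
      (\<forall>m r. r \<le> m \<longrightarrow> real (K m (e * m - (j * m + r))) = q (real m) (real r))"
  proof (cases "j < e")
    case True
    then obtain i where i: "e = Suc (i + j)" by (metis add.commute less_iff_Suc_add)
    have "real (K m (e * m - (j * m + r))) = p i (real m) (real m - real r)" if "r \<le> m" for m r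
    proof -
      have "e * m - (j * m + r) = i * m + (m - r)" using that by (simp add: i algebra_simps)
      then show ?thesis using p(2)[of "m - r" m i] that by (simp add: of_nat_diff)
    qed
    moreover have "bipoly n (\<lambda>m r. p i m (m - r))"
      by (rule bipoly_subst[OF p(1) bipoly_diff[OF bipoly_fst bipoly_snd]]) auto
    ultimately show ?thesis by blast
  next
    case False
    \<comment> \<open>The truncated difference is zero on the pieces to the right of \<open>e * m\<close>.\<close>
    then have "e * m - (j * m + r) = 0" for m r
      by (metis diff_is_0_eq mult_le_mono1 not_less trans_le_add1)
    moreover have "real (K m 0) = p 0 (real m) 0" for m using p(2)[of 0 m 0] by simp
    ultimately show ?thesis using bipoly_at_zero[OF p(1)[of 0]] by fastforce
  qed
qed

lemma sum_lessThan_mult_add: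
  "(\<Sum>u<j * m + r. f u) = (\<Sum>l<j. \<Sum>t<m. f (l * m + t)) + (\<Sum>t<r. f (j * m + t :: nat))"
  for f :: "nat \<Rightarrow> 'a::comm_monoid_add"
proof -
  have split: "(\<Sum>u<k + r. f u) = (\<Sum>u<k. f u) + (\<Sum>t<r. f (k + t))" for k r
    by (induction r) (simp_all add: add.assoc)
  have "(\<Sum>u<j * m. f u) = (\<Sum>l<j. \<Sum>t<m. f (l * m + t))"
  proof (induction j)
    case (Suc j)
    then show ?case using split[of "j * m" m] by (simp add: add.commute)
  qed simp
  then show ?thesis by (simp add: split)
qed

lemma piecewise_bipoly_sum:
  assumes "piecewise_bipoly n K"
  shows "piecewise_bipoly (Suc n) (\<lambda>m v. \<Sum>u\<le>v. K m u)"
  unfolding piecewise_bipoly_def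
proof
  fix j
  obtain p where p: "\<And>j. bipoly n (p j)"
    "\<And>j m r. r \<le> m \<Longrightarrow> real (K m (j * m + r)) = p j (real m) (real r)"
    using piecewise_bipolyE[OF assms] by blast
  obtain q where q: "\<And>j. bipoly (Suc n) (q j)"
    "\<And>j m r. (\<Sum>t<r. p j m (real t)) = q j m (real r)"
    using bipoly_partial_sum[OF p(1)] by metis
  define Q where "Q m r = (\<Sum>l<j. q l m m) + q j m r + p j m r" for m r
  have "bipoly (Suc n) Q"
    unfolding Q_def
    by (intro bipoly.add bipoly_sum q bipoly_mono[OF p(1)] bipoly_subst[OF q(1) bipoly_fst]) auto
  moreover have "real (\<Sum>u\<le>j * m + r. K m u) = Q (real m) (real r)" if "r \<le> m" for m r
  proof -
    have "real (\<Sum>u\<le>j * m + r. K m u) =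
        (\<Sum>l<j. \<Sum>t<m. real (K m (l * m + t))) + (\<Sum>t<r. real (K m (j * m + t)))
        + real (K m (j * m + r))"
      unfolding lessThan_Suc_atMost[symmetric] sum.lessThan_Suc of_nat_add of_nat_sum
        sum_lessThan_mult_add by (rule refl)
    also have "\<dots> = (\<Sum>l<j. \<Sum>t<m. p l (real m) (real t)) + (\<Sum>t<r. p j (real m) (real t))
        + p j (real m) (real r)"
      using that by (simp add: p(2))
    finally show ?thesis by (simp add: q(2) Q_def)
  qed
  ultimately show "\<exists>q. bipoly (Suc n) q \<and>
      (\<forall>m r. r \<le> m \<longrightarrow> real (\<Sum>u\<le>j * m + r. K m u) = q (real m) (real r))" by blast
qed

lemma piecewise_bipoly_truncate:
  assumes "piecewise_bipoly n K"
  shows "piecewise_bipoly n (\<lambda>m v. K m (min v (e * m)))"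
  unfolding piecewise_bipoly_def
proof
  fix j
  obtain p where p: "\<And>j. bipoly n (p j)"
    "\<And>j m r. r \<le> m \<Longrightarrow> real (K m (j * m + r)) = p j (real m) (real r)"
    using piecewise_bipolyE[OF assms] by blast
  show "\<exists>q. bipoly n q \<and>
      (\<forall>m r. r \<le> m \<longrightarrow> real (K m (min (j * m + r) (e * m))) = q (real m) (real r))"
  proof (cases "j < e")
    case True
    have "min (j * m + r) (e * m) = j * m + r" if "r \<le> m" for m r
    proof -
      have "j * m + r \<le> Suc j * m" using that by simp
      also have "\<dots> \<le> e * m" using True by (intro mult_le_mono1) simp
      finally show ?thesis by simp
    qed
    then show ?thesis using p by auto
  next
    case False
    then have "min (j * m + r) (e * m) = e * m" for m r
      by (metis min.absorb2 mult_le_mono1 not_less trans_le_add1)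
    moreover have "real (K m (e * m)) = p e (real m) 0" for m using p(2)[of 0 m e] by simp
    ultimately show ?thesis using bipoly_at_zero[OF p(1)[of e]] by fastforce
  qed
qed

section \<open>Counting lattice points one coordinate at a time\<close>

text \<open>
  The cap \<open>v\<close> on the last coordinate makes the count recursive: a new coordinate \<open>u\<close> restricts
  the earlier coordinates only by capping the last of them.

  A lattice point \<open>x\<close> vanishes at the index \<open>0\<close>, so the bound \<open>x 1 \<le> s * m\<close> on the first
  coordinate is the condition on the pair of indices \<open>0\<close>, \<open>1\<close> with this value of the bound
  at \<open>0\<close>, where \<open>delta 0 = 1\<close> would give \<open>s + 1\<close>.
\<close>

definition pair_bound :: "nat \<Rightarrow> nat \<Rightarrow> nat" where
  "pair_bound s i = (if i = 0 then s else s + delta i)"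

definition capped_points :: "nat \<Rightarrow> nat \<Rightarrow> nat \<Rightarrow> nat \<Rightarrow> (nat \<Rightarrow> real) set" where
  "capped_points s d m v = {x \<in> Zn d. (\<forall>i. 0 \<le> x i) \<and>
     (\<forall>i<d. x i + x (Suc i) \<le> real (pair_bound s i * m)) \<and> x d \<le> real v}"

fun capped_count :: "nat \<Rightarrow> nat \<Rightarrow> nat \<Rightarrow> nat \<Rightarrow> nat" where
  "capped_count s 0 m v = 1"
| "capped_count s (Suc d) m v =
     (\<Sum>u\<le>min v (pair_bound s d * m). capped_count s d m (pair_bound s d * m - u))"

lemma capped_points_0: "capped_points s 0 m v = {\<lambda>_. 0}"
  by (auto simp: capped_points_def Zn_def Rn_def)

lemma capped_points_Suc:
  "capped_points s (Suc d) m v = (\<Union>u\<le>min v (pair_bound s d * m).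
     (\<lambda>x. x(Suc d := real u)) ` capped_points s d m (pair_bound s d * m - u))"
  (is "?L = ?R")
proof (intro equalityI subsetI)
  fix x assume x: "x \<in> ?L"
  then have "x (Suc d) \<in> \<int>" "0 \<le> x (Suc d)" by (auto simp: capped_points_def Zn_def)
  then obtain u where u: "x (Suc d) = real u"
    by (metis Ints_cases nonneg_int_cases of_int_0_le_iff of_int_of_nat_eq)
  have nn: "0 \<le> x i" for i using x by (simp add: capped_points_def)
  have xd: "x d + real u \<le> real (pair_bound s d * m)" using x u by (auto simp: capped_points_def)
  with nn[of d] have le: "u \<le> pair_bound s d * m"
    by (metis add_increasing of_nat_le_iff order.refl order.trans)
  have uv: "u \<le> v" using x u by (simp add: capped_points_def)
  have "x(Suc d := 0) \<in> capped_points s d m (pair_bound s d * m - u)"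
    using x xd le by (auto simp: capped_points_def Zn_def Rn_def of_nat_diff)
  moreover have "x = (x(Suc d := 0))(Suc d := real u)" using u by auto
  ultimately show "x \<in> ?R" using le uv by (intro UN_I[of u] image_eqI[of x]) auto
next
  fix x assume "x \<in> ?R"
  then obtain u y where "u \<le> v" "u \<le> pair_bound s d * m" "x = y(Suc d := real u)"
    "y \<in> capped_points s d m (pair_bound s d * m - u)" by auto
  then show "x \<in> ?L"
    by (auto simp: capped_points_def Zn_def Rn_def of_nat_diff less_Suc_eq)
qed

lemma card_capped_points:
  "finite (capped_points s d m v) \<and> card (capped_points s d m v) = capped_count s d m v"
proof (induction d arbitrary: v)
  case 0
  then show ?case by (simp add: capped_points_0)
next
  case (Suc d)
  let ?f = "\<lambda>u x. x(Suc d := real u)"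
  let ?A = "\<lambda>u. capped_points s d m (pair_bound s d * m - u)"
  have inj: "inj_on (?f u) (?A u)" for u
  proof (rule inj_onI)
    fix x y assume "x \<in> ?A u" "y \<in> ?A u" and eq: "?f u x = ?f u y"
    then have "x (Suc d) = y (Suc d)" by (auto simp: capped_points_def Zn_def Rn_def)
    then show "x = y" using eq by (metis fun_upd_triv fun_upd_upd)
  qed
  have disj: "?f u ` ?A u \<inter> ?f w ` ?A w = {}" if "u \<noteq> w" for u w
    using that by (auto dest: fun_cong[of _ _ "Suc d"])
  have "card (capped_points s (Suc d) m v) =
      (\<Sum>u\<le>min v (pair_bound s d * m). card (?f u ` ?A u))"
    unfolding capped_points_Suc
    by (rule card_UN_disjoint) (use Suc disj in blast)+
  moreover have "finite (capped_points s (Suc d) m v)"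
    unfolding capped_points_Suc using Suc by blast
  ultimately show ?case by (simp add: card_image[OF inj] Suc)
qed

lemma piecewise_bipoly_capped_count: "piecewise_bipoly d (capped_count s d)"
proof (induction d)
  case 0
  then show ?case
    unfolding piecewise_bipoly_def by (auto intro!: exI[of _ "\<lambda>_ _. 1"] bipoly_const)
next
  case (Suc d)
  from piecewise_bipoly_truncate[OF piecewise_bipoly_sum[OF piecewise_bipoly_reflect[OF this]]]
  show ?case by (simp add: capped_count.simps(2)[abs_def])
qed

lemma polyP_pair_bound:
  "polyP s d = {x \<in> Rn d. (\<forall>i. 0 \<le> x i) \<and> (\<forall>i<d. x i + x (Suc i) \<le> real (pair_bound s i))}"
proof -
  consider "d = 0" | "d = 1" | "d \<ge> 2" by linarith
  then show ?thesis
  proof cases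
    case 1
    have "Rn 0 = {\<lambda>_. 0}" by (auto simp: Rn_def)
    then show ?thesis using 1 by (simp add: polyP_def) auto
  next
    case 2
    have line: "(\<forall>i. 0 \<le> x i) \<longleftrightarrow> 0 \<le> x 1" "x 0 = 0" if "x \<in> Rn 1" for x
    proof -
      have "x i = 0" if "i \<noteq> 1" for i using \<open>x \<in> Rn 1\<close> that by (auto simp: Rn_def)
      then show "(\<forall>i. 0 \<le> x i) \<longleftrightarrow> 0 \<le> x 1" "x 0 = 0" by (metis order.refl, simp)
    qed
    have "x \<in> polyP s d \<longleftrightarrow> x \<in> {x \<in> Rn d. (\<forall>i. 0 \<le> x i) \<and>
        (\<forall>i<d. x i + x (Suc i) \<le> real (pair_bound s i))}" for x
      using 2 line[of x] by (cases "x \<in> Rn 1") (auto simp: polyP_def pair_bound_def)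
    then show ?thesis by blast
  next
    case 3
    show ?thesis
    proof (intro equalityI subsetI)
      fix x assume "x \<in> polyP s d"
      then have x: "x \<in> Rn d" "\<And>i. i \<in> {1..d} \<Longrightarrow> 0 \<le> x i"
        "\<And>i. i \<in> {1..d - 1} \<Longrightarrow> x i + x (i + 1) \<le> real (s + delta i)"
        using 3 by (auto simp: polyP_def)
      have x0: "x 0 = 0" using x(1) by (simp add: Rn_def)
      have nn: "0 \<le> x i" for i
        using x(1,2) by (cases "i \<in> {1..d}") (auto simp: Rn_def)
      have "(1 :: nat) \<in> {1..d - 1}" using 3 by auto
      then have "x 1 \<le> real s"
        using x(3)[of 1] nn[of 2] by (simp add: delta_def numeral_2_eq_2)
      then have "x i + x (Suc i) \<le> real (pair_bound s i)" if "i < d" for i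
        using x(3)[of i] x0 that by (cases "i = 0") (auto simp: pair_bound_def)
      with x(1) nn
      show "x \<in> {x \<in> Rn d. (\<forall>i. 0 \<le> x i) \<and>
          (\<forall>i<d. x i + x (Suc i) \<le> real (pair_bound s i))}" by simp
    next
      fix x assume "x \<in> {x \<in> Rn d. (\<forall>i. 0 \<le> x i) \<and>
          (\<forall>i<d. x i + x (Suc i) \<le> real (pair_bound s i))}"
      then have x: "x \<in> Rn d" "\<forall>i. 0 \<le> x i"
        "\<And>i. i < d \<Longrightarrow> x i + x (Suc i) \<le> real (pair_bound s i)" by blast+
      have "x i + x (i + 1) \<le> real (s + delta i)" if "i \<in> {1..d - 1}" for i
      proof -
        have "i < d" "i \<noteq> 0" using that 3 by auto
        then show ?thesis using x(3)[of i] by (simp add: pair_bound_def)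
      qed
      with x(1,2) have "x \<in> {x \<in> Rn d. (\<forall>i\<in>{1..d}. 0 \<le> x i) \<and>
          (\<forall>i\<in>{1..d - 1}. x i + x (i + 1) \<le> real (s + delta i))}" by blast
      then show "x \<in> polyP s d" using 3 by (simp add: polyP_def)
    qed
  qed
qed

lemma dilate_polyP:
  "dilate m (polyP s d) =
     {x \<in> Rn d. (\<forall>i. 0 \<le> x i) \<and> (\<forall>i<d. x i + x (Suc i) \<le> real (pair_bound s i * m))}"
  (is "_ = ?R")
proof (intro equalityI subsetI)
  fix x assume "x \<in> dilate m (polyP s d)"
  then obtain y where y: "y \<in> polyP s d" "x = (\<lambda>i. real m * y i)" by (auto simp: dilate_def)
  have "x i + x (Suc i) \<le> real (pair_bound s i * m)" if "i < d" for i
  proof -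
    have "real m * (y i + y (Suc i)) \<le> real m * real (pair_bound s i)"
      using y(1) that by (intro mult_left_mono) (auto simp: polyP_pair_bound)
    then show ?thesis by (simp add: y(2) algebra_simps)
  qed
  then show "x \<in> ?R" using y by (auto simp: polyP_pair_bound Rn_def)
next
  fix x assume x: "x \<in> ?R"
  show "x \<in> dilate m (polyP s d)"
  proof (cases "m = 0")
    case True
    have "x i = 0" for i
    proof (cases "i \<in> {1..d}")
      case i: True
      then obtain k where "i = Suc k" "k < d" by (cases i) auto
      with x True have "x k + x i \<le> 0" "0 \<le> x k" "0 \<le> x i" by auto
      then show ?thesis by linarith
    qed (use x in \<open>auto simp: Rn_def\<close>)
    then have "x = (\<lambda>i. real m * 0)" by auto
    moreover have "(\<lambda>_. 0) \<in> polyP s d" by (simp add: polyP_pair_bound Rn_def)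
    ultimately show ?thesis unfolding dilate_def by (intro image_eqI[of _ _ "\<lambda>_. 0"]) auto
  next
    case False
    have "x i / m + x (Suc i) / m \<le> real (pair_bound s i)" if "i < d" for i
      using x that False by (simp add: add_divide_distrib[symmetric] pos_divide_le_eq)
    then have "(\<lambda>i. x i / m) \<in> polyP s d"
      using x by (simp add: polyP_pair_bound Rn_def)
    moreover have "x = (\<lambda>i. real m * (x i / m))" using False by auto
    ultimately show ?thesis unfolding dilate_def by (intro image_eqI) auto
  qed
qed

text \<open>
  The cap \<open>(s + 1) * m\<close> on the last coordinate is implied by the other inequalities.
\<close>

lemma ehrhart_eq_capped_count: "ehrhart s d m = capped_count s d m (Suc s * m)"
proof -
  have cap: "x d \<le> real (Suc s * m)"
    if "x \<in> Zn d" "\<forall>i. 0 \<le> x i" "\<forall>i<d. x i + x (Suc i) \<le> real (pair_bound s i * m)" for x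
  proof (cases d)
    case 0
    then show ?thesis using that(1) by (simp add: Zn_def Rn_def)
  next
    case (Suc k)
    then have "x k + x d \<le> real (pair_bound s k * m)" "0 \<le> x k" using that by auto
    moreover have "pair_bound s k * m \<le> Suc s * m"
      by (intro mult_le_mono1) (simp add: pair_bound_def delta_def)
    ultimately show ?thesis using of_nat_mono[of "pair_bound s k * m" "Suc s * m", where 'a = real]
      by linarith
  qed
  have "dilate m (polyP s d) \<inter> Zn d = capped_points s d m (Suc s * m)"
    using cap by (auto simp: dilate_polyP capped_points_def Zn_def)
  then show ?thesis by (simp add: ehrhart_def card_capped_points)
qed

section \<open>Existence of the numerator polynomial\<close>

definition has_numerator :: "nat \<Rightarrow> real fps \<Rightarrow> bool" where
  "has_numerator n F \<longleftrightarrow> (\<exists>h. degree h \<le> n \<and> F * (1 - fps_X) ^ Suc n = fps_of_poly h)"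

lemma has_numerator_add:
  "has_numerator n F \<Longrightarrow> has_numerator n G \<Longrightarrow> has_numerator n (F + G)"
  unfolding has_numerator_def
  by (metis degree_add_le distrib_right fps_of_poly_add)

lemma has_numerator_cmult:
  "has_numerator n F \<Longrightarrow> has_numerator n (fps_const c * F)"
  unfolding has_numerator_def
  by (metis degree_smult_le fps_of_poly_smult mult.assoc order.trans)

lemma fps_of_poly_one_minus_X: "fps_of_poly [:1, - 1:] = (1 - fps_X :: real fps)"
  by (simp add: fps_of_poly_pCons)

lemma has_numerator_Suc:
  assumes "has_numerator n F"
  shows "has_numerator (Suc n) F"
proof -
  obtain h where h: "degree h \<le> n" "F * (1 - fps_X) ^ Suc n = fps_of_poly h"
    using assms by (auto simp: has_numerator_def)
  have "F * (1 - fps_X) ^ Suc (Suc n) = fps_of_poly (h * [:1, - 1:])"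
    using h(2) by (simp add: fps_of_poly_mult fps_of_poly_one_minus_X mult_ac del: mult_pCons_right)
  moreover have "degree (h * [:1, - 1:]) \<le> Suc n"
    using degree_mult_le[of h "[:1, - 1:]"] h(1) by (simp del: mult_pCons_right)
  ultimately show ?thesis unfolding has_numerator_def by blast
qed

lemma has_numerator_mono:
  assumes "n \<le> k" "has_numerator n F"
  shows "has_numerator k F"
  using assms(1) by (induction k rule: dec_induct) (auto intro: has_numerator_Suc assms(2))

text \<open>
  Differentiating \<open>F = h / (1 - X) ^ (n + 1)\<close> gives
  \<open>X F' = X (h' (1 - X) + (n + 1) h) / (1 - X) ^ (n + 2)\<close>.
\<close>

lemma has_numerator_X_deriv:
  assumes "has_numerator n F"
  shows "has_numerator (Suc n) (fps_X * fps_deriv F)"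
proof -
  obtain h where h: "degree h \<le> n" "F * (1 - fps_X) ^ Suc n = fps_of_poly h"
    using assms by (auto simp: has_numerator_def)
  define Y :: "real fps" where "Y = 1 - fps_X"
  define k where "k = [:0, 1:] * (pderiv h * [:1, - 1:] + smult (real (Suc n)) h)"
  have "fps_deriv (Y ^ Suc n) = - (fps_const (real (Suc n)) * Y ^ n)"
    unfolding fps_deriv_power by (simp add: Y_def del: of_nat_Suc fps_const_neg)
  then have D: "fps_deriv (F * Y ^ Suc n) =
      fps_deriv F * Y ^ Suc n - fps_const (real (Suc n)) * F * Y ^ n"
    by (simp add: algebra_simps del: power_Suc of_nat_Suc)
  have "fps_deriv (fps_of_poly h) * Y = fps_deriv (F * Y ^ Suc n) * Y"
    using h(2) by (simp only: Y_def)
  also have "\<dots> = fps_deriv F * Y ^ Suc (Suc n) - fps_const (real (Suc n)) * (F * Y ^ Suc n)"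
    unfolding D by (simp add: algebra_simps del: of_nat_Suc)
  also have "F * Y ^ Suc n = fps_of_poly h"
    using h(2) by (simp only: Y_def)
  finally have "fps_deriv F * Y ^ Suc (Suc n) =
      fps_deriv (fps_of_poly h) * Y + fps_const (real (Suc n)) * fps_of_poly h"
    by (simp only: eq_diff_eq)
  then have "fps_X * fps_deriv F * Y ^ Suc (Suc n) = fps_of_poly k"
    unfolding k_def fps_of_poly_mult fps_of_poly_add fps_of_poly_smult fps_of_poly_pderiv
      fps_of_poly_fps_X fps_of_poly_one_minus_X Y_def[symmetric]
    by (simp only: mult.assoc)
  moreover have "degree k \<le> Suc n"
  proof -
    have "degree (pderiv h * [:1, - 1:]) \<le> n"
    proof (cases "degree h = 0")
      case True
      then show ?thesis by (simp add: pderiv_eq_0_iff[THEN iffD2])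
    next
      case False
      then show ?thesis
        using degree_mult_le[of "pderiv h" "[:1, - 1:]"] h(1)
        by (simp add: degree_pderiv del: mult_pCons_right)
    qed
    then have "degree (pderiv h * [:1, - 1:] + smult (real (Suc n)) h) \<le> n"
      using h(1) degree_smult_le[of "real (Suc n)" h] by (intro degree_add_le) auto
    then show ?thesis unfolding k_def
      using degree_mult_le[of "[:0, 1:]" "pderiv h * [:1, - 1:] + smult (real (Suc n)) h"]
      by (simp del: mult_pCons_right mult_pCons_left)
  qed
  ultimately show ?thesis unfolding has_numerator_def Y_def by blast
qed

lemma has_numerator_power: "has_numerator a (Abs_fps (\<lambda>m. real m ^ a))"
proof (induction a)
  case 0
  have "Abs_fps (\<lambda>m. 1) * (1 - fps_X) = (1 :: real fps)"
    by (rule fps_ext) (simp add: right_diff_distrib)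
  then show ?case by (auto simp: has_numerator_def intro!: exI[of _ 1])
next
  case (Suc a)
  have "Abs_fps (\<lambda>m. real m ^ Suc a) = fps_X * fps_deriv (Abs_fps (\<lambda>m. real m ^ a))"
    by (rule fps_ext) (auto simp del: of_nat_Suc)
  with has_numerator_X_deriv[OF Suc] show ?case by simp
qed

lemma has_numerator_bipoly:
  assumes "bipoly n p"
  shows "has_numerator n (Abs_fps (\<lambda>m. p (real m) 0))"
  using assms
proof (induction rule: bipoly.induct)
  case (monom a b c)
  have "Abs_fps (\<lambda>m. c * real m ^ a * 0 ^ b) =
      fps_const (c * 0 ^ b) * Abs_fps (\<lambda>m. real m ^ a)"
    by (rule fps_ext) simp
  moreover have "has_numerator n (Abs_fps (\<lambda>m. real m ^ a))"
    using monom by (intro has_numerator_mono[OF _ has_numerator_power]) simp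
  ultimately show ?case by (simp add: has_numerator_cmult)
next
  case (add f g)
  have "Abs_fps (\<lambda>m. f (real m) 0 + g (real m) 0) =
      Abs_fps (\<lambda>m. f (real m) 0) + Abs_fps (\<lambda>m. g (real m) 0)"
    by (rule fps_ext) simp
  with has_numerator_add[OF add.IH] show ?case by simp
qed

lemma hstar_numerator:
  "Abs_fps (\<lambda>m. real (ehrhart s d m)) * (1 - fps_X) ^ Suc d = fps_of_poly (hstar s d)"
proof -
  let ?F = "Abs_fps (\<lambda>m. real (ehrhart s d m))"
  let ?Q = "(1 - fps_X) ^ (d + 1) :: real fps"
  obtain p where p: "bipoly d p" "\<And>m. real (ehrhart s d m) = p (real m) 0"
    using piecewise_bipoly_at_multiple[OF piecewise_bipoly_capped_count]
    by (metis ehrhart_eq_capped_count)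
  obtain h where h: "degree h \<le> d" "?F * ?Q = fps_of_poly h"
    using has_numerator_bipoly[OF p(1)] by (auto simp: has_numerator_def p(2))
  have Q: "?Q $ 0 \<noteq> 0" by (simp add: fps_nth_power_0)
  have inv: "inverse ?Q * ?Q = 1" using Q by (rule inverse_mult_eq_1)
  have iff: "?F = fps_of_poly g / ?Q \<longleftrightarrow> ?F * ?Q = fps_of_poly g" for g
  proof
    assume "?F = fps_of_poly g / ?Q"
    then have "?F * ?Q = fps_of_poly g * (inverse ?Q * ?Q)"
      by (simp only: fps_divide_unit[OF Q] mult.assoc)
    then show "?F * ?Q = fps_of_poly g" by (simp only: inv mult_1_right)
  next
    assume "?F * ?Q = fps_of_poly g"
    then have "fps_of_poly g / ?Q = (?F * ?Q) * inverse ?Q"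
      by (simp only: fps_divide_unit[OF Q])
    also have "\<dots> = ?F * (inverse ?Q * ?Q)" by (simp only: mult_ac)
    finally show "?F = fps_of_poly g / ?Q" by (simp only: inv mult_1_right)
  qed
  have "hstar s d = h"
    unfolding hstar_def iff
    using h by (intro the_equality) (simp, simp only: fps_of_poly_eq_iff)
  with h show ?thesis by simp
qed

section \<open>The generating function identity\<close>

lemma fps_nth_subst_scaled:
  "fps_nth (fps_nth (subst_scaled g) i) d = fps_nth ((1 - fps_X) ^ d) i * fps_nth g d"
  by (simp add: subst_scaled_def fps_swap_def)

text \<open>
  Only the terms with \<open>m \<le> k\<close> contribute to the coefficient of \<open>X ^ k\<close>.
\<close>

lemma sums_fps_mult_X_power:
  fixes f :: "nat \<Rightarrow> 'a :: comm_ring_1 fps"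
  shows "(\<lambda>m. f m * fps_X ^ m) sums Abs_fps (\<lambda>k. \<Sum>m\<le>k. fps_nth (f m) (k - m))"
  unfolding sums_def
proof (rule tendsto_fpsI)
  fix k
  have "fps_nth (\<Sum>m<N. f m * fps_X ^ m) k = (\<Sum>m\<le>k. fps_nth (f m) (k - m))" if "k < N" for N
  proof -
    have "fps_nth (\<Sum>m<N. f m * fps_X ^ m) k =
        (\<Sum>m<N. if m \<le> k then fps_nth (f m) (k - m) else 0)"
      by (auto simp: fps_sum_nth fps_X_power_mult_right_nth not_le intro!: sum.cong)
    also have "\<dots> = (\<Sum>m\<le>k. fps_nth (f m) (k - m))"
      using that by (intro sum.mono_neutral_cong_right) auto
    finally show ?thesis .
  qed
  then show "\<forall>\<^sub>F N in sequentially. fps_nth (\<Sum>m<N. f m * fps_X ^ m) k =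
      fps_nth (Abs_fps (\<lambda>k. \<Sum>m\<le>k. fps_nth (f m) (k - m))) k"
    by (auto intro!: eventually_mono[OF eventually_gt_at_top[of k]])
qed

lemma fps_nth_one_minus_X_mult:
  "fps_nth ((1 - fps_X) * F) k = fps_nth F k - (if k = 0 then 0 else fps_nth F (k - 1))"
  for F :: "'a :: comm_ring_1 fps"
  by (simp add: left_diff_distrib)

theorem proposition3p8:
  fixes s :: nat
  assumes "s \<ge> 1"
  shows "Hgen s = fps_swap (Abs_fps (\<lambda>d. fps_of_poly (hstar s d)))
    \<and> summable (\<lambda>m. subst_scaled (Gser s m) * fps_X ^ m)
    \<and> Hgen s = (1 - fps_X) * (\<Sum>m. subst_scaled (Gser s m) * fps_X ^ m)
    \<and> (\<forall>k. Hser s k =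
          fps_nth ((1 - fps_X) * (\<Sum>m. subst_scaled (Gser s m) * fps_X ^ m)) k)"
proof -
  let ?t = "\<lambda>m. subst_scaled (Gser s m) * fps_X ^ m"
  define S where "S = Abs_fps (\<lambda>k. \<Sum>m\<le>k. fps_nth (subst_scaled (Gser s m)) (k - m))"
  have sums: "?t sums S" unfolding S_def by (rule sums_fps_mult_X_power)
  \<comment> \<open>Both variables are read off coefficientwise: for fixed \<open>d\<close> the coefficients of \<open>y ^ d\<close>
      form the Ehrhart series in \<open>z\<close> multiplied by \<open>(1 - z) ^ d\<close>.\<close>
  have S_nth: "fps_nth (fps_nth S k) d =
      fps_nth (Abs_fps (\<lambda>m. real (ehrhart s d m)) * (1 - fps_X) ^ d) k" for k d
    by (simp add: S_def fps_sum_nth fps_nth_subst_scaled Gser_def fps_mult_nth atMost_atLeast0)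
      (simp add: mult.commute)
  have H: "Hgen s = (1 - fps_X) * S"
  proof (intro fps_ext)
    fix k d
    let ?F = "Abs_fps (\<lambda>m. real (ehrhart s d m)) * (1 - fps_X) ^ d"
    have "fps_nth (fps_nth ((1 - fps_X) * S) k) d = fps_nth ((1 - fps_X) * ?F) k"
      unfolding fps_nth_one_minus_X_mult by (simp add: S_nth)
    also have "(1 - fps_X) * ?F = fps_of_poly (hstar s d)"
      unfolding hstar_numerator[symmetric] by (simp add: mult_ac)
    finally show "fps_nth (fps_nth (Hgen s) k) d = fps_nth (fps_nth ((1 - fps_X) * S) k) d"
      by (simp add: Hgen_def Hser_def)
  qed
  have "Hgen s = fps_swap (Abs_fps (\<lambda>d. fps_of_poly (hstar s d)))"
    by (simp add: Hgen_def Hser_def fps_swap_def fps_eq_iff)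
  moreover have "Hser s k = fps_nth (Hgen s) k" for k by (simp add: Hgen_def)
  ultimately show ?thesis
    using H sums_summable[OF sums] sums_unique[OF sums] by simp
qed

end
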